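(* Let $N\ge 1$, let $-1=x_0<x_1<\cdots<x_N=1$ be a grid, and let $\mathcal S=\{s_1,\ldots,s_N\}$ be a family of $N$ pairwise distinct intervals $s_i=[x_{\ell_i},x_{r_i}]$ with integers $0\le \ell_i<r_i\le N$. Let $A_{\mathcal S}\in\mathbb R^{N\times N}$ be the associated interval matrix. If $A_{\mathcal S}$ is nonsingular, then $$\left\|A_{\mathcal S}^{-1}\right\|_\infty=\max_{1\le j\le N}|\mathcal P_j|,$$ where $|\mathcal P_j|$ is the number of edges in the unique path joining $j-1$ to $j$ in the endpoint graph of $\mathcal S$.
   Context: The interval matrix is $[A_{\mathcal S}]_{ij}=1$ if $\ell_i<j\le r_i$ and $0$ otherwise, $i,j=1,\ldots,N$. The endpoint graph of $\mathcal S$ is the undirected graph with vertex set $\{0,1,\ldots,N\}$ and edge set $\{\{\ell_i,r_i\}: i=1,\ldots,N\}$; when $A_{\mathcal S}$ is nonsingular this graph is a tree, so the path $\mathcal P_j$ from $j-1$ to $j$ exists and is unique. $\|\cdot\|_\infty$ is the matrix norm induced by the vector $\infty$-norm (maximum absolute row sum). *)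

theory Defs
  imports
    "HOL-Analysis.Analysis"
    "Jordan_Normal_Form.Gauss_Jordan_Elimination"
    "Graph_Theory.Graph_Theory"
begin

text \<open>
  Matrix rows and columns are numbered from \<open>0\<close> by the matrix type, whereas intervals and grid
  cells are numbered \<open>1, \<dots>, N\<close>; hence the shift by \<open>Suc\<close>.
\<close>

definition interval_matrix :: "nat \<Rightarrow> (nat \<Rightarrow> nat) \<Rightarrow> (nat \<Rightarrow> nat) \<Rightarrow> real mat" where
  "interval_matrix N l r =
     mat N N (\<lambda>(i, j). if l (Suc i) < Suc j \<and> Suc j \<le> r (Suc i) then 1 else 0)"

text \<open>
  Undirected graphs are symmetric digraphs here: each edge is represented by its two orientations.
\<close>

definition endpoint_graph :: "nat \<Rightarrow> (nat \<Rightarrow> nat) \<Rightarrow> (nat \<Rightarrow> nat) \<Rightarrow> nat pair_pre_digraph" where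
  "endpoint_graph N l r =
     \<lparr> pverts = {0..N}, parcs = (\<Union>i\<in>{1..N}. {(l i, r i), (r i, l i)}) \<rparr>"

lemma pair_graph_endpoint_graph:
  assumes "\<And>i. i \<in> {1..N} \<Longrightarrow> l i < r i \<and> r i \<le> N"
  shows "pair_graph (endpoint_graph N l r)"
proof
  fix e assume e: "e \<in> parcs (endpoint_graph N l r)"
  then obtain i where "i \<in> {1..N}" "e = (l i, r i) \<or> e = (r i, l i)"
    by (auto simp: endpoint_graph_def)
  with assms[of i]
  show "fst e \<in> pverts (endpoint_graph N l r)" "snd e \<in> pverts (endpoint_graph N l r)"
    "fst e \<noteq> snd e"
    by (auto simp: endpoint_graph_def)
next
  show "symmetric (endpoint_graph N l r)"
    unfolding symmetric_def by (auto simp: endpoint_graph_def sym_def)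
qed (auto simp: endpoint_graph_def)

text \<open>
  A path is a walk without repeated vertices, given as its list of (oriented) edges, so
  \<^const>\<open>length\<close> counts its edges.  The following is meaningful only if there is exactly one path
  from \<open>u\<close> to \<open>v\<close>, as in a tree.
\<close>

definition unique_path :: "'a pair_pre_digraph \<Rightarrow> 'a \<Rightarrow> 'a \<Rightarrow> ('a \<times> 'a) list" where
  "unique_path G u v = (THE p. pre_digraph.apath (with_proj G) u p v)"

text \<open>The \<open>0\<close> below only matters for vectors of dimension \<open>0\<close>.\<close>

definition vec_inf_norm :: "real vec \<Rightarrow> real" where
  "vec_inf_norm v = Max (insert 0 ((\<lambda>i. \<bar>v $ i\<bar>) ` {..<dim_vec v}))"

definition mat_inf_norm :: "real mat \<Rightarrow> real" where
  "mat_inf_norm A =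
     (SUP v \<in> {v \<in> carrier_vec (dim_col A). v \<noteq> 0\<^sub>v (dim_col A)}.
        vec_inf_norm (A *\<^sub>v v) / vec_inf_norm v)"

lemma vec_inf_norm_ge: "i < dim_vec v \<Longrightarrow> \<bar>v $ i\<bar> \<le> vec_inf_norm v"
  unfolding vec_inf_norm_def by (rule Max_ge) auto

lemma vec_inf_norm_le:
  assumes "0 \<le> c" "\<And>i. i < dim_vec v \<Longrightarrow> \<bar>v $ i\<bar> \<le> c"
  shows "vec_inf_norm v \<le> c"
  unfolding vec_inf_norm_def using assms by (subst Max_le_iff) auto

lemma vec_inf_norm_pos:
  assumes "v \<in> carrier_vec n" "v \<noteq> 0\<^sub>v n"
  shows "vec_inf_norm v > 0"
proof -
  obtain i where "i < n" "v $ i \<noteq> 0" using assms by (metis carrier_vecD eq_vecI index_zero_vec)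
  then show ?thesis using vec_inf_norm_ge[of i v] assms(1) by auto
qed

lemma mat_inf_norm_eq_max_row_sum:
  assumes "0 < dim_row A" "0 < dim_col A"
  shows "mat_inf_norm A = (MAX i\<in>{..<dim_row A}. \<Sum>j<dim_col A. \<bar>A $$ (i, j)\<bar>)"
    (is "_ = ?M")
proof -
  let ?n = "dim_col A"
  let ?V = "{v \<in> carrier_vec ?n. v \<noteq> 0\<^sub>v ?n}"
  let ?q = "\<lambda>v. vec_inf_norm (A *\<^sub>v v) / vec_inf_norm v"
  let ?row = "\<lambda>i. \<Sum>j<?n. \<bar>A $$ (i, j)\<bar>"
  have row_le: "?row i \<le> ?M" if "i < dim_row A" for i
    using that by (intro Max_ge) auto
  have M0: "0 \<le> ?M" 
    by (rule order_trans[OF _ row_le[OF assms(1)]]) (simp add: sum_nonneg)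
  have entry: "(A *\<^sub>v v) $ i = (\<Sum>j<?n. A $$ (i, j) * v $ j)"
    if "i < dim_row A" "v \<in> carrier_vec ?n" for i v
    using that by (auto simp: scalar_prod_def lessThan_atLeast0)
  have upper: "?q v \<le> ?M" if v: "v \<in> ?V" for v
  proof -
    have pos: "vec_inf_norm v > 0" using v vec_inf_norm_pos by blast
    have "vec_inf_norm (A *\<^sub>v v) \<le> ?M * vec_inf_norm v"
    proof (rule vec_inf_norm_le)
      fix i assume "i < dim_vec (A *\<^sub>v v)"
      then have i: "i < dim_row A" by simp
      have "\<bar>(A *\<^sub>v v) $ i\<bar> \<le> (\<Sum>j<?n. \<bar>A $$ (i, j) * v $ j\<bar>)"
        using v by (subst entry[OF i]) (auto intro: sum_abs)
      also have "\<dots> \<le> (\<Sum>j<?n. \<bar>A $$ (i, j)\<bar> * vec_inf_norm v)"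
        using v by (intro sum_mono) (auto simp: abs_mult intro!: mult_left_mono vec_inf_norm_ge)
      also have "\<dots> = ?row i * vec_inf_norm v" by (simp add: sum_distrib_right)
      also have "\<dots> \<le> ?M * vec_inf_norm v" using row_le[OF i] pos by (intro mult_right_mono) auto
      finally show "\<bar>(A *\<^sub>v v) $ i\<bar> \<le> ?M * vec_inf_norm v" .
    qed (use M0 pos in auto)
    then show ?thesis using pos by (simp add: divide_le_eq)
  qed
  have "?M \<in> ?row ` {..<dim_row A}" using assms by (intro Max_in) auto
  then obtain i where i: "i < dim_row A" "?M = ?row i" by auto
  let ?v = "vec ?n (\<lambda>j. if A $$ (i, j) < 0 then -1 else 1 :: real)"
  have vV: "?v \<in> ?V" using assms(2) by (auto simp: vec_eq_iff split: if_splits intro!: exI[of _ 0])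
  have "(A *\<^sub>v ?v) $ i = ?row i"
    using i(1) by (subst entry) (auto intro!: sum.cong)
  then have "?M \<le> vec_inf_norm (A *\<^sub>v ?v)"
    using vec_inf_norm_ge[of i "A *\<^sub>v ?v"] i by simp
  moreover have "vec_inf_norm ?v \<le> 1" by (rule vec_inf_norm_le) auto
  moreover have "vec_inf_norm ?v > 0" using vV vec_inf_norm_pos by blast
  ultimately have lower: "?M \<le> ?q ?v"
    using M0 by (simp add: le_divide_eq) (meson mult_left_le order_trans)
  have "?q ?v \<le> mat_inf_norm A"
    unfolding mat_inf_norm_def using vV upper by (intro cSUP_upper bdd_aboveI2[of _ _ ?M]) auto
  moreover have "mat_inf_norm A \<le> ?M"
    unfolding mat_inf_norm_def by (rule cSUP_least) (use vV upper in \<open>blast+\<close>)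
  ultimately show ?thesis using lower by linarith
qed

end

theory Submission
  imports Defs
begin

text \<open>
  A vector \<open>f\<close> on the grid cells is the difference sequence of a potential \<open>F\<close> on the grid points,
  \<open>f\<^sub>k = F (k) - F (k - 1)\<close>, and the row of the interval matrix that belongs to \<open>s\<^sub>i\<close> computes the
  potential drop \<open>F (r\<^sub>i) - F (l\<^sub>i)\<close> along the edge \<open>{l\<^sub>i, r\<^sub>i}\<close> of the endpoint graph.  Inverting the
  matrix means recovering the potential drop over each cell \<open>[j - 1, j]\<close> from the drops along the
  edges, and this is done by summing the latter, with signs, along a walk from \<open>j - 1\<close> to \<open>j\<close>.
  Hence the signed edge counts of \<^emph>\<open>every\<close> such walk form row \<open>j\<close> of the inverse
  (\<open>inverse_row_eq_net_traversals\<close>).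

  A path uses each edge at most once and in only one direction, so its signed counts are \<open>0\<close> or
  \<open>\<plusminus>1\<close> and the absolute row sum is its length.  Its signed counts also determine its set of arcs,
  and thereby the path itself; as they are prescribed by the inverse, there is at most one path from
  \<open>j - 1\<close> to \<open>j\<close>.  There is one, because the indicator function of the set of points reachable from
  \<open>j - 1\<close> is a potential without drop along any edge; its difference sequence lies in the kernel,
  so the indicator is constant.
\<close>

section \<open>Paths and their sets of arcs\<close>

context pair_wf_digraph
begin

text \<open>
  Following an arc after its reversal, even with other arcs in between, leads back to the vertex
  from which the reversal started.
\<close>

lemma apath_no_reversed_arc:
  assumes "apath u p v" and "(a, b) \<in> set p"
  shows "(b, a) \<notin> set p"
  using assms
proof (induction p arbitrary: u)
  case (Cons e p)
  from Cons.prems have p: "apath (snd e) p v" and fresh: "fst e \<notin> set (pawalk_verts (snd e) p)"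
    by (auto simp: apath_Cons_iff)
  have visited: "fst e' \<in> set (pawalk_verts (snd e) p) \<and> snd e' \<in> set (pawalk_verts (snd e) p)"
    if "e' \<in> set p" for e'
    using that awalk_verts_arc1[of e' p "snd e"] awalk_verts_arc2[of "snd e" p v e'] p
    by (auto simp: apath_def)
  have "snd e \<in> set (pawalk_verts (snd e) p)"
    using p by (cases p) (auto simp: apath_Cons_iff)
  with fresh have "fst e \<noteq> snd e" by auto
  then show ?case using Cons.IH[OF p] Cons.prems(2) visited fresh by fastforce
qed simp

lemma distinct_apath:
  assumes "apath u p v"
  shows "distinct p"
  using assms distinct_verts_imp_distinct[of u p v] by (auto simp: apath_def)

text \<open>
  The arcs of a path leave pairwise distinct vertices, so the one to be followed next is
  determined by the vertex that has been reached.
\<close>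

lemma apath_eqI:
  assumes "apath u p v" and "apath u q w" and "set p = set q"
  shows "p = q"
  using assms
proof (induction p arbitrary: u q)
  case (Cons e p)
  then obtain f q' where q: "q = f # q'" by (cases q) auto
  have p': "apath (snd e) p v" "fst e = u"
    using Cons.prems(1) by (auto simp: apath_Cons_iff)
  have q': "apath (snd f) q' w" "fst f = u" "u \<notin> set (pawalk_verts (snd f) q')"
    using Cons.prems(2) by (auto simp: q apath_Cons_iff)
  have "e \<notin> set q'"
    using awalk_verts_arc1[of e q' "snd f"] p' q' by auto
  with Cons.prems(3) have "e = f" by (auto simp: q)
  moreover have "set p = set q'"
    using distinct_apath[OF Cons.prems(1)] distinct_apath[OF Cons.prems(2)] Cons.prems(3)
      \<open>e = f\<close> by (auto simp: q)
  ultimately show ?case using Cons.IH[OF p'(1)] q' by (auto simp: q)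
qed simp

end

section \<open>Signed edge counts of walks in the endpoint graph\<close>

definition net_traversals :: "(nat \<Rightarrow> nat) \<Rightarrow> (nat \<Rightarrow> nat) \<Rightarrow> (nat \<times> nat) list \<Rightarrow> nat \<Rightarrow> real" where
  "net_traversals l r p i = real (count_list p (l i, r i)) - real (count_list p (r i, l i))"

locale interval_family =
  fixes N :: nat and l r :: "nat \<Rightarrow> nat"
  assumes interval_bounds: "i \<in> {1..N} \<Longrightarrow> l i < r i \<and> r i \<le> N"
    and inj_endpoints: "inj_on (\<lambda>i. (l i, r i)) {1..N}"
begin

sublocale pair_graph "endpoint_graph N l r"
  by (rule pair_graph_endpoint_graph) (rule interval_bounds)

text \<open>
  Different intervals span different edges.  So a sum over the steps of a walk can be regrouped
  as a sum over the intervals; it is needed for the length of a walk and for the potential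
  drop along it.
\<close>

lemma sum_list_walk_eq_sum_intervals:
  fixes w :: "nat \<times> nat \<Rightarrow> real"
  assumes "set p \<subseteq> parcs (endpoint_graph N l r)"
  shows "sum_list (map w p) =
    (\<Sum>i\<in>{1..N}. count_list p (l i, r i) * w (l i, r i) + count_list p (r i, l i) * w (r i, l i))"
  using assms
proof (induction p)
  case (Cons e p)
  obtain i where i: "i \<in> {1..N}" and e: "e = (l i, r i) \<or> e = (r i, l i)"
    using Cons.prems by (auto simp: endpoint_graph_def)
  \<comment> \<open>The contribution of interval \<open>k\<close> for the one-step walk \<open>[e]\<close>; only the interval \<open>i\<close> that spans
    \<open>e\<close> contributes, and in only one of the two orientations, because an edge is not a loop.\<close>
  let ?single = "\<lambda>k. (if e = (l k, r k) then w (l k, r k) else 0) +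
    (if e = (r k, l k) then w (r k, l k) else 0)"
  have nonloop: "l k \<noteq> r k" "r k \<noteq> l k" "l k < r k" if "k \<in> {1..N}" for k
    using interval_bounds[OF that] by simp_all
  have other: "?single k = 0" if k: "k \<in> {1..N}" "k \<noteq> i" for k
  proof -
    have "(l k, r k) \<noteq> (l i, r i)"
      using inj_onD[OF inj_endpoints _ k(1) i] k(2) by blast
    moreover have "(l k, r k) \<noteq> (r i, l i)"
      using nonloop(3)[OF i] nonloop(3)[OF k(1)] by (metis Pair_inject order_less_asym)
    ultimately have "e \<noteq> (l k, r k)" and "e \<noteq> (r k, l k)"
      using e by (metis Pair_inject)+
    then show ?thesis by simp
  qed
  have "(\<Sum>k\<in>{1..N}. ?single k) = ?single i + (\<Sum>k\<in>{1..N} - {i}. ?single k)"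
    using i by (intro sum.remove) simp_all
  also have "(\<Sum>k\<in>{1..N} - {i}. ?single k) = 0"
    using other by (intro sum.neutral) blast
  also have "?single i + 0 = w e"
    using e nonloop[OF i] by (elim disjE) simp_all
  finally have single: "(\<Sum>k\<in>{1..N}. ?single k) = w e" .
  have step: "real (count_list (e # p) a) * w a = (if e = a then w a else 0) + count_list p a * w a"
    for a
    by (simp add: algebra_simps)
  have "sum_list (map w p) =
    (\<Sum>i\<in>{1..N}. count_list p (l i, r i) * w (l i, r i) + count_list p (r i, l i) * w (r i, l i))"
    using Cons.prems by (intro Cons.IH) simp
  then have "sum_list (map w (e # p)) = (\<Sum>k\<in>{1..N}. ?single k) +
    (\<Sum>i\<in>{1..N}. count_list p (l i, r i) * w (l i, r i) + count_list p (r i, l i) * w (r i, l i))"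
    by (simp only: single list.map sum_list.Cons)
  also have "\<dots> = (\<Sum>i\<in>{1..N}. count_list (e # p) (l i, r i) * w (l i, r i)
      + count_list (e # p) (r i, l i) * w (r i, l i))"
    unfolding sum.distrib[symmetric] step by (intro sum.cong refl) (simp only: ac_simps)
  finally show ?case .
qed simp

lemma potential_drop_along_walk:
  fixes F :: "nat \<Rightarrow> real"
  assumes "awalk u p v"
  shows "(\<Sum>i\<in>{1..N}. net_traversals l r p i * (F (r i) - F (l i))) = F v - F u"
proof -
  have "(\<Sum>i\<in>{1..N}. net_traversals l r p i * (F (r i) - F (l i))) =
    sum_list (map (\<lambda>e. F (snd e) - F (fst e)) p)"
    using assms
    by (subst sum_list_walk_eq_sum_intervals)
      (auto simp: awalk_def net_traversals_def algebra_simps intro!: sum.cong)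
  also have "\<dots> = F v - F u"
    using assms by (induction p arbitrary: u) (auto simp: awalk_simps)
  finally show ?thesis .
qed

lemma abs_net_traversals_apath:
  assumes "apath u p v"
  shows "\<bar>net_traversals l r p i\<bar> = count_list p (l i, r i) + count_list p (r i, l i)"
  using apath_no_reversed_arc[OF assms, of "l i" "r i"]
  by (cases "(l i, r i) \<in> set p") (auto simp: net_traversals_def)

lemma sum_abs_net_traversals_apath:
  assumes "apath u p v"
  shows "(\<Sum>i\<in>{1..N}. \<bar>net_traversals l r p i\<bar>) = length p"
proof -
  have "real (length p) = sum_list (map (\<lambda>e. 1 :: real) p)"
    by (simp add: sum_list_triv)
  also have "\<dots> = (\<Sum>i\<in>{1..N}. \<bar>net_traversals l r p i\<bar>)"
    using assms
    by (subst sum_list_walk_eq_sum_intervals)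
      (auto simp: apath_def awalk_def abs_net_traversals_apath[OF assms])
  finally show ?thesis by simp
qed

text \<open>The arcs on a path can be read off from the signs of the signed counts.\<close>

lemma apath_eq_if_net_traversals_eq:
  assumes p: "apath u p v" and q: "apath u q v"
    and eq: "\<And>i. i \<in> {1..N} \<Longrightarrow> net_traversals l r p i = net_traversals l r q i"
  shows "p = q"
proof (rule apath_eqI[OF p q])
  have sign: "(l i, r i) \<in> set p' \<longleftrightarrow> net_traversals l r p' i > 0"
    "(r i, l i) \<in> set p' \<longleftrightarrow> net_traversals l r p' i < 0" if "apath u p' v" for p' i
    using apath_no_reversed_arc[OF that, of "l i" "r i"] count_list_0_iff[of p' "(l i, r i)"]
      count_list_0_iff[of p' "(r i, l i)"]
    by (auto simp: net_traversals_def)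
  have arcs: "set p' \<subseteq> (\<Union>i\<in>{1..N}. {(l i, r i), (r i, l i)})" if "apath u p' v" for p'
  proof -
    have "set p' \<subseteq> parcs (endpoint_graph N l r)"
      using that by (auto simp: apath_def)
    then show ?thesis by (simp add: endpoint_graph_def)
  qed
  have incl: "set p' \<subseteq> set q'" if p': "apath u p' v" and q': "apath u q' v"
    and eq': "\<And>i. i \<in> {1..N} \<Longrightarrow> net_traversals l r p' i = net_traversals l r q' i" for p' q'
  proof
    fix e assume e: "e \<in> set p'"
    then obtain i where "i \<in> {1..N}" "e = (l i, r i) \<or> e = (r i, l i)"
      using arcs[OF p'] by auto
    then show "e \<in> set q'" using e sign[OF p', of i] sign[OF q', of i] eq'[of i] by auto
  qed
  show "set p = set q"
    using incl[OF p q eq] incl[OF q p eq[symmetric]] by auto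
qed

lemma interval_matrix_carrier: "interval_matrix N l r \<in> carrier_mat N N"
  by (simp add: interval_matrix_def)

lemma interval_matrix_mult_difference_sequence:
  fixes F :: "nat \<Rightarrow> real"
  assumes "i < N"
  shows "(\<Sum>k<N. interval_matrix N l r $$ (i, k) * (F (Suc k) - F k)) =
    F (r (Suc i)) - F (l (Suc i))"
proof -
  have i: "l (Suc i) < r (Suc i)" "r (Suc i) \<le> N"
    using interval_bounds[of "Suc i"] assms by auto
  have "(\<Sum>k<N. interval_matrix N l r $$ (i, k) * (F (Suc k) - F k)) =
    (\<Sum>k\<in>{l (Suc i)..<r (Suc i)}. F (Suc k) - F k)"
    using assms i by (intro sum.mono_neutral_cong_right) (auto simp: interval_matrix_def)
  also have "\<dots> = F (r (Suc i)) - F (l (Suc i))"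
    using i by (intro sum_Suc_diff') auto
  finally show ?thesis .
qed

end

section \<open>The inverse of the interval matrix\<close>

locale nonsingular_interval_family = interval_family +
  fixes B :: "real mat"
  assumes inverse_carrier: "B \<in> carrier_mat N N"
    and right_inverse: "interval_matrix N l r * B = 1\<^sub>m N"
    and left_inverse: "B * interval_matrix N l r = 1\<^sub>m N"
begin

lemma right_inverse_entry:
  assumes "i < N" "j < N"
  shows "(\<Sum>k<N. interval_matrix N l r $$ (i, k) * B $$ (k, j)) = (if i = j then 1 else 0)"
proof -
  have "(interval_matrix N l r * B) $$ (i, j) = (if i = j then 1 else 0)"
    using assms by (simp add: right_inverse)
  then show ?thesis
    using assms inverse_carrier interval_matrix_carrier
    by (auto simp: scalar_prod_def lessThan_atLeast0)
qed

lemma left_inverse_entry: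
  assumes "i < N" "j < N"
  shows "(\<Sum>k<N. B $$ (i, k) * interval_matrix N l r $$ (k, j)) = (if i = j then 1 else 0)"
proof -
  have "(B * interval_matrix N l r) $$ (i, j) = (if i = j then 1 else 0)"
    using assms by (simp add: left_inverse)
  then show ?thesis
    using assms inverse_carrier interval_matrix_carrier
    by (auto simp: scalar_prod_def lessThan_atLeast0)
qed

text \<open>
  Column \<open>k\<close> of the interval matrix holds the drops of the potential that jumps from \<open>0\<close> to \<open>1\<close>
  between the points \<open>k\<close> and \<open>k + 1\<close>.  The drop of this potential along a walk from \<open>j\<close> to \<open>j + 1\<close> is
  \<open>1\<close> if \<open>k = j\<close> and \<open>0\<close> otherwise, so multiplying the signed counts by the interval matrix yields a
  unit vector.
\<close>

lemma inverse_row_eq_net_traversals: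
  assumes walk: "awalk j p (Suc j)" and j: "j < N" and i: "i < N"
  shows "B $$ (j, i) = net_traversals l r p (Suc i)"
proof -
  let ?A = "interval_matrix N l r"
  let ?c = "\<lambda>m. net_traversals l r p (Suc m)"
  have unit: "(\<Sum>m<N. ?c m * ?A $$ (m, k)) = (if k = j then 1 else 0)" if k: "k < N" for k
  proof -
    define F :: "nat \<Rightarrow> real" where "F v = (if k < v then 1 else 0)" for v
    have "?A $$ (m, k) = F (r (Suc m)) - F (l (Suc m))" if "m < N" for m
      using interval_bounds[of "Suc m"] that k by (auto simp: interval_matrix_def F_def)
    then have "(\<Sum>m<N. ?c m * ?A $$ (m, k)) = (\<Sum>m<N. ?c m * (F (r (Suc m)) - F (l (Suc m))))"
      by simp
    also have "\<dots> = (\<Sum>m\<in>{1..N}. net_traversals l r p m * (F (r m) - F (l m)))"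
      by (simp add: sum.atLeast1_atMost_eq)
    also have "\<dots> = F (Suc j) - F j"
      by (rule potential_drop_along_walk[OF walk])
    finally show ?thesis by (auto simp: F_def)
  qed
  have "B $$ (j, i) = (\<Sum>k<N. (if k = j then 1 else 0) * B $$ (k, i))"
    using j by (simp add: if_distrib[of "\<lambda>x. x * _"] cong: if_cong)
  also have "\<dots> = (\<Sum>k<N. \<Sum>m<N. ?c m * (?A $$ (m, k) * B $$ (k, i)))"
    by (intro sum.cong) (simp_all add: unit[symmetric] sum_distrib_right mult.assoc)
  also have "\<dots> = (\<Sum>m<N. ?c m * (\<Sum>k<N. ?A $$ (m, k) * B $$ (k, i)))"
    by (subst sum.swap) (simp add: sum_distrib_left)
  also have "\<dots> = (\<Sum>m<N. ?c m * (if m = i then 1 else 0))"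
    using i by (intro sum.cong) (simp_all add: right_inverse_entry)
  also have "\<dots> = ?c i"
    using i by (simp add: if_distrib[of "\<lambda>x. _ * x"] cong: if_cong)
  finally show ?thesis .
qed

text \<open>
  The difference sequence of a potential that is constant on the components of the endpoint graph
  lies in the kernel of the interval matrix.
\<close>

lemma potential_constant_if_no_drop:
  fixes F :: "nat \<Rightarrow> real"
  assumes no_drop: "\<And>i. i \<in> {1..N} \<Longrightarrow> F (l i) = F (r i)" and j: "j < N"
  shows "F (Suc j) = F j"
proof -
  let ?A = "interval_matrix N l r"
  let ?f = "\<lambda>k. F (Suc k) - F k"
  have "?f j = (\<Sum>k<N. (if j = k then 1 else 0) * ?f k)"
    using j by (simp add: if_distrib[of "\<lambda>x. x * _"] cong: if_cong)
  also have "\<dots> = (\<Sum>k<N. \<Sum>m<N. B $$ (j, m) * (?A $$ (m, k) * ?f k))"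
    using j by (intro sum.cong) (simp_all add: left_inverse_entry[symmetric] sum_distrib_right mult.assoc)
  also have "\<dots> = (\<Sum>m<N. B $$ (j, m) * (\<Sum>k<N. ?A $$ (m, k) * ?f k))"
    by (subst sum.swap) (simp add: sum_distrib_left)
  also have "\<dots> = 0"
    by (intro sum.neutral) (auto simp: interval_matrix_mult_difference_sequence no_drop)
  finally show ?thesis by simp
qed

lemma ex_apath_over_cell:
  assumes "j < N"
  shows "\<exists>p. apath j p (Suc j)"
proof -
  let ?G = "with_proj (endpoint_graph N l r)"
  define F :: "nat \<Rightarrow> real" where "F v = (if j \<rightarrow>\<^sup>*\<^bsub>?G\<^esub> v then 1 else 0)" for v
  have "F (l i) = F (r i)" if "i \<in> {1..N}" for i
  proof -
    have "(l i, r i) \<in> parcs (endpoint_graph N l r)" "(r i, l i) \<in> parcs (endpoint_graph N l r)"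
      using that by (auto simp: endpoint_graph_def)
    then have "j \<rightarrow>\<^sup>*\<^bsub>?G\<^esub> l i \<longleftrightarrow> j \<rightarrow>\<^sup>*\<^bsub>?G\<^esub> r i"
      using reachable_adj_trans by auto
    then show ?thesis by (simp add: F_def)
  qed
  then have "F (Suc j) = F j"
    using assms by (intro potential_constant_if_no_drop)
  moreover have "j \<rightarrow>\<^sup>*\<^bsub>?G\<^esub> j"
    using assms by (intro reachable_refl) (simp add: endpoint_graph_def)
  ultimately have "j \<rightarrow>\<^sup>*\<^bsub>?G\<^esub> Suc j"
    by (simp add: F_def split: if_splits)
  then show ?thesis by (simp only: reachable_apath)
qed

lemma apath_unique_path_over_cell:
  assumes "j < N"
  shows "apath j (unique_path (endpoint_graph N l r) j (Suc j)) (Suc j)"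
  unfolding unique_path_def
proof (rule theI')
  have "p = q" if p: "apath j p (Suc j)" and q: "apath j q (Suc j)" for p q
  proof (rule apath_eq_if_net_traversals_eq[OF p q])
    fix i assume "i \<in> {1..N}"
    then obtain i' where i': "i = Suc i'" "i' < N" by (cases i) auto
    have "B $$ (j, i') = net_traversals l r p' i" if "apath j p' (Suc j)" for p'
      unfolding i'(1) using assms i'(2) that
      by (intro inverse_row_eq_net_traversals) (auto simp: apath_def)
    from this[OF p] this[OF q] show "net_traversals l r p i = net_traversals l r q i" by simp
  qed
  with ex_apath_over_cell[OF assms] show "\<exists>!p. apath j p (Suc j)" by blast
qed

lemma inverse_row_sum_eq_path_length:
  assumes "j < N"
  shows "(\<Sum>i<N. \<bar>B $$ (j, i)\<bar>) = length (unique_path (endpoint_graph N l r) j (Suc j))"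
proof -
  let ?p = "unique_path (endpoint_graph N l r) j (Suc j)"
  have path: "apath j ?p (Suc j)" by (rule apath_unique_path_over_cell[OF assms])
  then have "(\<Sum>i<N. \<bar>B $$ (j, i)\<bar>) = (\<Sum>i<N. \<bar>net_traversals l r ?p (Suc i)\<bar>)"
    using assms by (intro sum.cong) (auto simp: apath_def inverse_row_eq_net_traversals)
  also have "\<dots> = (\<Sum>i\<in>{1..N}. \<bar>net_traversals l r ?p i\<bar>)"
    by (simp add: sum.atLeast1_atMost_eq)
  finally show ?thesis using sum_abs_net_traversals_apath[OF path] by simp
qed

lemma mat_inf_norm_inverse:
  assumes "N \<ge> 1"
  shows "mat_inf_norm B =
    real (MAX j\<in>{1..N}. length (unique_path (endpoint_graph N l r) (j - 1) j))"
proof -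
  let ?len = "\<lambda>j. length (unique_path (endpoint_graph N l r) (j - 1) j)"
  have "mat_inf_norm B = (MAX j\<in>{..<N}. \<Sum>i<N. \<bar>B $$ (j, i)\<bar>)"
    using inverse_carrier assms by (subst mat_inf_norm_eq_max_row_sum) auto
  also have "(\<lambda>j. \<Sum>i<N. \<bar>B $$ (j, i)\<bar>) ` {..<N} = (\<lambda>j. real (?len (Suc j))) ` {..<N}"
    by (intro image_cong) (simp_all add: inverse_row_sum_eq_path_length)
  also have "\<dots> = real ` ?len ` {1..N}"
    by (simp only: image_image image_Suc_lessThan[symmetric])
  also have "Max \<dots> = real (MAX j\<in>{1..N}. ?len j)"
    using assms by (intro mono_Max_commute[symmetric]) (auto intro: monoI)
  finally show ?thesis .
qed

end

lemma mat_inverse_invertible: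
  fixes A :: "'a :: field mat"
  assumes A: "A \<in> carrier_mat n n" and inv: "invertible_mat A"
  shows "the (mat_inverse A) \<in> carrier_mat n n"
    and "A * the (mat_inverse A) = 1\<^sub>m n" and "the (mat_inverse A) * A = 1\<^sub>m n"
proof -
  obtain B where AB: "A * B = 1\<^sub>m n" and BA: "B * A = 1\<^sub>m (dim_row B)"
    using assms by (auto simp: invertible_mat_def inverts_mat_def)
  have "dim_col B = n" using arg_cong[OF AB, of dim_col] by simp
  moreover have "dim_row B = n" using arg_cong[OF BA, of dim_col] A by simp
  ultimately have "A \<in> Units (ring_mat TYPE('a) n ())"
    using A AB BA by (auto simp: Units_def ring_mat_simps intro!: bexI[of _ B])
  then obtain C where "mat_inverse A = Some C"
    using mat_inverse(1)[OF A, of "()"] by (cases "mat_inverse A") auto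
  with mat_inverse(2)[OF A this]
  show "the (mat_inverse A) \<in> carrier_mat n n"
    "A * the (mat_inverse A) = 1\<^sub>m n" "the (mat_inverse A) * A = 1\<^sub>m n"
    by auto
qed

theorem corollary1:
  fixes N :: nat and x :: "nat \<Rightarrow> real" and l r :: "nat \<Rightarrow> nat" and s :: "nat \<Rightarrow> real set"
  assumes "N \<ge> 1"
    and "x 0 = -1" and "x N = 1" and "strict_mono_on {0..N} x"
    and "\<And>i. i \<in> {1..N} \<Longrightarrow> l i < r i \<and> r i \<le> N"
    and "\<And>i. i \<in> {1..N} \<Longrightarrow> s i = {x (l i)..x (r i)}"
    and "inj_on s {1..N}"
    and "invertible_mat (interval_matrix N l r)"
  shows "mat_inf_norm (the (mat_inverse (interval_matrix N l r))) =
    real (MAX j\<in>{1..N}. length (unique_path (endpoint_graph N l r) (j - 1) j))"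
proof -
  let ?B = "the (mat_inverse (interval_matrix N l r))"
  have carrier: "interval_matrix N l r \<in> carrier_mat N N"
    by (simp add: interval_matrix_def)
  interpret nonsingular_interval_family N l r ?B
  proof
    show "inj_on (\<lambda>i. (l i, r i)) {1..N}"
    proof (rule inj_onI)
      fix i k assume ik: "i \<in> {1..N}" "k \<in> {1..N}" and "(l i, r i) = (l k, r k)"
      then have "s i = s k" by (simp only: assms(6) prod.inject)
      with assms(7) show "i = k" using ik by (rule inj_onD)
    qed
  qed (fact assms(5) mat_inverse_invertible[OF carrier assms(8)])+
  show ?thesis using assms(1) by (rule mat_inf_norm_inverse)
qed

end
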